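(* Let $b_n\ge0$ ($n\ge1$) be integers and, for $p\in[0,1]$, define the stopping time $T^p_{b_1,b_2,\dots}=\inf\{n\ge1:|S_n^p|\ge b_n\}$. Then $T^p_{b_1,b_2,\dots}$ is stochastically increasing in $p\in[0,\frac12]$ and stochastically decreasing in $p\in[\frac12,1]$.
   Context: For $p\in[0,1]$, $(S_n^p)_{n\ge 0}$ is the Bernoulli random walk $S_0^p=0$, $S_n^p=X_1^p+\cdots+X_n^p$ ($n\ge 1$), where $X_1^p,X_2^p,\dots$ are i.i.d. with $P(X_n^p=1)=p$ and $P(X_n^p=-1)=1-p$. Convention: $\inf\emptyset=\infty$. A family of $\{1,2,\dots\}\cup\{\infty\}$-valued random variables $T^p$ is stochastically increasing (resp. decreasing) in $p$ on an interval if for every $n\ge1$ the probability $P(T^p>n)$ is non-decreasing (resp. non-increasing) in $p$ on that interval (the usual stochastic order). *)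

theory Defs
  imports "HOL-Probability.Probability"
begin

text \<open>Independent steps with values \<open>\<plusminus>1\<close> almost surely; only the indices \<open>n \<ge> 1\<close> matter.\<close>

locale bernoulli_steps = prob_space M
  for M :: "'a measure" and X :: "nat \<Rightarrow> 'a \<Rightarrow> int" and p :: real +
  assumes indep_steps: "indep_vars (\<lambda>_. count_space UNIV) X {1..}"
    and prob_step_up: "\<And>n. n \<ge> 1 \<Longrightarrow> prob {\<omega> \<in> space M. X n \<omega> = 1} = p"
    and prob_step_down: "\<And>n. n \<ge> 1 \<Longrightarrow> prob {\<omega> \<in> space M. X n \<omega> = - 1} = 1 - p"

definition walk :: "(nat \<Rightarrow> 'a \<Rightarrow> int) \<Rightarrow> nat \<Rightarrow> 'a \<Rightarrow> int" where
  "walk X n \<omega> = (\<Sum>i=1..n. X i \<omega>)"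

text \<open>The infimum is taken in \<^typ>\<open>enat\<close>, where the infimum of the empty set is \<open>\<infinity>\<close>.\<close>

definition exit_time :: "(nat \<Rightarrow> int) \<Rightarrow> (nat \<Rightarrow> 'a \<Rightarrow> int) \<Rightarrow> 'a \<Rightarrow> enat" where
  "exit_time b X \<omega> = Inf {enat n | n. n \<ge> 1 \<and> \<bar>walk X n \<omega>\<bar> \<ge> b n}"

text \<open>The variable \<open>T p\<close> lives on its own probability space \<open>M p\<close>.\<close>

definition stoch_increasing_on ::
    "real set \<Rightarrow> (real \<Rightarrow> 'a measure) \<Rightarrow> (real \<Rightarrow> 'a \<Rightarrow> enat) \<Rightarrow> bool" where
  "stoch_increasing_on I M T \<longleftrightarrow>
    (\<forall>n\<ge>1. mono_on I (\<lambda>p. measure (M p) {\<omega> \<in> space (M p). T p \<omega> > enat n}))"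

definition stoch_decreasing_on ::
    "real set \<Rightarrow> (real \<Rightarrow> 'a measure) \<Rightarrow> (real \<Rightarrow> 'a \<Rightarrow> enat) \<Rightarrow> bool" where
  "stoch_decreasing_on I M T \<longleftrightarrow>
    (\<forall>n\<ge>1. antimono_on I (\<lambda>p. measure (M p) {\<omega> \<in> space (M p). T p \<omega> > enat n}))"

end

theory Submission
  imports Defs
begin

text \<open>
  Although \<open>S\<close> is biased, \<open>\<bar>S\<bar>\<close> is a Markov chain: given the path of \<open>\<bar>S\<bar>\<close> up to a time at which it
  equals \<open>k\<close>, the walk is at \<open>k\<close> or \<open>-k\<close> with odds \<open>p\<^sup>k : q\<^sup>k\<close>, where \<open>q = 1 - p\<close>. So from
  \<open>k \<ge> 1\<close> the chain moves up with probability
  \<open>f\<^sub>k = (p\<^bsup>k+1\<^esup> + q\<^bsup>k+1\<^esup>) / (p\<^sup>k + q\<^sup>k)\<close>. The power sums satisfy a two-term linear recurrence,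
  which turns into \<open>f\<^bsub>k+1\<^esub> = 1 - p q / f\<^sub>k\<close>. Hence \<open>f\<^sub>k\<close> depends on \<open>p\<close> only through \<open>c = p q\<close>, and
  by induction on \<open>k\<close> it decreases when \<open>c\<close> increases. Since \<open>c\<close> increases in \<open>p\<close> on \<open>[0, 1/2]\<close> and
  decreases on \<open>[1/2, 1]\<close>, it suffices that the probability of staying below the barrier
  increases with \<open>c\<close>.

  The chain moves by \<open>\<plusminus>1\<close>, so two copies started at distinct positions of equal parity
  cannot cross in one step, whatever their transition probabilities are. The barrier only kills high positions. Therefore
  the survival probability, as a function of the position, decreases in steps of two, and a smaller chance of
  moving up can only raise it.

  The argument is carried out for backward recursions. \<open>expectation_alive_reward\<close> removes
  the last step of the walk by independence, \<open>folds_to_step\<close> is the passage from \<open>S\<close> to \<open>\<bar>S\<bar>\<close> (an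
  algebraic identity for the odds \<open>p\<^sup>k : q\<^sup>k\<close>, so no conditional distributions occur), and
  \<open>two_step_decreasing_step\<close> with \<open>abs_step_mono\<close> gives the comparison.
\<close>

section \<open>Walk expectations by backward recursion\<close>

definition alive :: "(nat \<Rightarrow> int) \<Rightarrow> (nat \<Rightarrow> int) \<Rightarrow> nat \<Rightarrow> bool" where
  "alive b s n \<longleftrightarrow> (\<forall>k\<in>{1..n}. \<bar>s k\<bar> < b k)"

lemma alive_Suc: "alive b s (Suc n) \<longleftrightarrow> alive b s n \<and> \<bar>s (Suc n)\<bar> < b (Suc n)"
  by (auto simp: alive_def le_Suc_eq)

lemma exit_time_greater_iff: "enat n < exit_time b X \<omega> \<longleftrightarrow> alive b (\<lambda>k. walk X k \<omega>) n"
proof -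
  let ?H = "{enat k | k. k \<ge> 1 \<and> \<bar>walk X k \<omega>\<bar> \<ge> b k}"
  have "enat n < Inf ?H \<longleftrightarrow> (\<forall>t\<in>?H. enat n < t)"
  proof (cases "?H = {}")
    case False
    then have "Inf ?H \<in> ?H"
      by (metis (no_types, lifting) ex_in_conv wellorder_InfI)
    moreover have "Inf ?H \<le> t" if "t \<in> ?H" for t
      using that by (rule Inf_lower)
    ultimately show ?thesis
      by (meson order_less_le_trans)
  next
    case True
    show ?thesis
      unfolding True by (simp add: top_enat_def)
  qed
  also have "\<dots> \<longleftrightarrow> (\<forall>k\<ge>1. b k \<le> \<bar>walk X k \<omega>\<bar> \<longrightarrow> n < k)"
    by auto
  also have "\<dots> \<longleftrightarrow> alive b (\<lambda>k. walk X k \<omega>) n"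
    unfolding alive_def by (meson atLeastAtMost_iff not_le)
  finally show ?thesis
    unfolding exit_time_def .
qed

text \<open>
  The transition operator of the walk killed at the barrier: the barrier value \<open>\<beta>\<close> is tested
  after the move, because the exit time ignores time \<open>0\<close>.
\<close>

definition walk_step :: "real \<Rightarrow> int \<Rightarrow> (int \<Rightarrow> real) \<Rightarrow> int \<Rightarrow> real" where
  "walk_step p \<beta> g x =
    p * (of_bool (\<bar>x + 1\<bar> < \<beta>) * g (x + 1)) + (1 - p) * (of_bool (\<bar>x - 1\<bar> < \<beta>) * g (x - 1))"

text \<open>
  The recursion consumes the barrier from its last entry, so a reward at time \<open>Suc n\<close> becomes a
  reward at time \<open>n\<close>. This matches the independence of a step from the steps before it.
\<close>

primrec walk_value :: "real \<Rightarrow> (nat \<Rightarrow> int) \<Rightarrow> nat \<Rightarrow> (int \<Rightarrow> real) \<Rightarrow> int \<Rightarrow> real" where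
  "walk_value p b 0 g = g"
| "walk_value p b (Suc n) g = walk_value p b n (walk_step p (b (Suc n)) g)"

lemma walk_step_bounds:
  assumes "p \<in> {0..1}" and "\<And>x. g x \<in> {0..1}"
  shows "walk_step p \<beta> g x \<in> {0..1}"
proof -
  define u d where "u = of_bool (\<bar>x + 1\<bar> < \<beta>) * g (x + 1)"
    and "d = of_bool (\<bar>x - 1\<bar> < \<beta>) * g (x - 1)"
  have "u \<in> {0..1}" "d \<in> {0..1}"
    using assms(2)[of "x + 1"] assms(2)[of "x - 1"] by (auto simp: u_def d_def)
  then have "p * u + (1 - p) * d \<in> {0..1}"
    using assms(1) by (auto intro!: convex_bound_le)
  then show ?thesis
    by (simp add: walk_step_def u_def d_def)
qed

context bernoulli_steps
begin

lemma p_bounds: "p \<in> {0..1}"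
  using prob_step_up[of 1] measure_nonneg[of M] prob_le_1 by (metis atLeastAtMost_iff order_refl)

lemma measurable_step [measurable]: "i \<ge> 1 \<Longrightarrow> X i \<in> measurable M (count_space UNIV)"
  using indep_steps by (auto simp: indep_vars_def)

text \<open>
  A finite product of countable discrete spaces is discrete, so every function of finitely many
  steps is a random variable.
\<close>

lemma measurable_path_function:
  fixes F :: "(nat \<Rightarrow> int) \<Rightarrow> real"
  shows "(\<lambda>\<omega>. F (restrict (\<lambda>i. X i \<omega>) {1..n})) \<in> borel_measurable M"
proof -
  have "(\<lambda>\<omega>. restrict (\<lambda>i. X i \<omega>) {1..n}) \<in> measurable M (PiM {1..n} (\<lambda>_. count_space UNIV))"
    by (intro measurable_restrict measurable_step) auto
  moreover have "F \<in> borel_measurable (PiM {1..n} (\<lambda>_. count_space UNIV))"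
    by (subst count_space_PiM_finite) auto
  ultimately show ?thesis
    by (rule measurable_compose)
qed

lemma expectation_next_step:
  fixes F :: "(nat \<Rightarrow> int) \<Rightarrow> real"
  assumes F: "\<And>v. F v \<in> {0..1}"
  shows "expectation (\<lambda>\<omega>. of_bool (X (Suc n) \<omega> = s) * F (restrict (\<lambda>i. X i \<omega>) {1..n})) =
    prob {\<omega> \<in> space M. X (Suc n) \<omega> = s} * expectation (\<lambda>\<omega>. F (restrict (\<lambda>i. X i \<omega>) {1..n}))"
proof -
  let ?path = "\<lambda>A \<omega>. restrict (\<lambda>i. X i \<omega>) A"
  let ?PM = "\<lambda>A. PiM A (\<lambda>_::nat. count_space (UNIV :: int set))"
  let ?H = "\<lambda>v :: nat \<Rightarrow> int. of_bool (v (Suc n) = s) :: real"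
  have meas: "G \<in> borel_measurable (?PM A)" if "finite A" for G :: "(nat \<Rightarrow> int) \<Rightarrow> real" and A
    using that by (subst count_space_PiM_finite) auto
  have "indep_var (?PM {Suc n}) (?path {Suc n}) (?PM {1..n}) (?path {1..n})"
    by (rule indep_var_restrict[OF indep_steps]) auto
  from indep_var_compose[OF this, of ?H borel F borel]
  have indep: "indep_var borel (\<lambda>\<omega>. of_bool (X (Suc n) \<omega> = s) :: real)
      borel (\<lambda>\<omega>. F (?path {1..n} \<omega>))"
    by (simp add: meas comp_def)
  have up: "(\<lambda>\<omega>. of_bool (X (Suc n) \<omega> = s) :: real) \<in> borel_measurable M"
    using measurable_compose[OF measurable_step, of "Suc n" "\<lambda>y. of_bool (y = s) :: real" borel] by simp
  have int1: "integrable M (\<lambda>\<omega>. of_bool (X (Suc n) \<omega> = s) :: real)"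
  proof (rule integrable_const_bound[where B=1])
    show "AE \<omega> in M. norm (of_bool (X (Suc n) \<omega> = s) :: real) \<le> 1"
      by (rule AE_I2) simp
  qed (rule up)
  have int2: "integrable M (\<lambda>\<omega>. F (?path {1..n} \<omega>))"
  proof (rule integrable_const_bound[where B=1])
    show "AE \<omega> in M. norm (F (?path {1..n} \<omega>)) \<le> 1"
      using F by (intro AE_I2) (simp add: abs_le_iff)
  qed (rule measurable_path_function)
  have "expectation (\<lambda>\<omega>. of_bool (X (Suc n) \<omega> = s)) =
      expectation (indicator {\<omega> \<in> space M. X (Suc n) \<omega> = s} :: 'a \<Rightarrow> real)"
    by (intro Bochner_Integration.integral_cong) (auto simp: indicator_def)
  also have "\<dots> = prob {\<omega> \<in> space M. X (Suc n) \<omega> = s}"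
    by (simp add: Int_def conj_commute)
  finally show ?thesis
    using indep_var_lebesgue_integral[OF indep int1 int2] by simp
qed

text \<open>The two step probabilities add up to \<open>1\<close>, which leaves no mass for other integers.\<close>

lemma AE_step: "AE \<omega> in M. X (Suc n) \<omega> = 1 \<or> X (Suc n) \<omega> = - 1"
proof -
  let ?U = "\<lambda>s. {\<omega> \<in> space M. X (Suc n) \<omega> = s}"
  have ev: "?U s \<in> events" for s
    using measurable_sets[OF measurable_step, of "Suc n" "{s}"] by (simp add: vimage_def Int_def conj_commute)
  have "prob (?U 1 \<union> ?U (- 1)) = prob (?U 1) + prob (?U (- 1))"
    by (intro finite_measure_Union ev) auto
  also have "\<dots> = 1"
    by (simp add: prob_step_up prob_step_down)
  finally have "AE \<omega> in M. \<omega> \<in> ?U 1 \<union> ?U (- 1)"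
    by (rule AE_prob_1)
  then show ?thesis
    by (rule AE_mp) auto
qed

text \<open>
  A general reward \<open>g\<close>, rather than the constant \<open>1\<close>, lets the induction absorb one step of the
  walk into it; its bounds keep every integrand integrable.
\<close>

lemma expectation_alive_reward:
  assumes g: "\<And>x. g x \<in> {0..1}"
  shows "expectation (\<lambda>\<omega>. of_bool (alive b (\<lambda>k. walk X k \<omega>) n) * g (walk X n \<omega>)) =
    walk_value p b n g 0"
  using g
proof (induction n arbitrary: g)
  case 0
  then show ?case
    by (simp add: alive_def walk_def prob_space)
next
  case (Suc n)
  define path where "path \<omega> = restrict (\<lambda>i. X i \<omega>) {1..n}" for \<omega>
  define F where "F h v =
    of_bool (alive b (\<lambda>k. \<Sum>i=1..k. v i) n) * (h (\<Sum>i=1..n. v i) :: real)" for h v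
  \<comment> \<open>the reward seen from time \<open>n\<close> if the next step is \<open>s\<close>\<close>
  define h where "h s x = of_bool (\<bar>x + s\<bar> < b (Suc n)) * g (x + s)" for s x
  have F_path: "F f (path \<omega>) = of_bool (alive b (\<lambda>k. walk X k \<omega>) n) * f (walk X n \<omega>)" for f \<omega>
    by (simp add: F_def path_def alive_def walk_def)
  have h01: "h s x \<in> {0..1}" for s x
    using Suc.prems[of "x + s"] by (auto simp: h_def)
  have F01: "F (h s) v \<in> {0..1}" for s v
    using h01[of s "\<Sum>i=1..n. v i"] by (auto simp: F_def)
  have F_meas [measurable]: "(\<lambda>\<omega>. F f (path \<omega>)) \<in> borel_measurable M" for f
    unfolding path_def by (rule measurable_path_function)
  have step_meas [measurable]: "X (Suc n) \<in> measurable M (count_space UNIV)"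
    by simp
  have F_int: "integrable M (\<lambda>\<omega>. F (h s) (path \<omega>))" for s
    using F01[of s] by (intro integrable_const_bound[where B=1] F_meas) auto
  let ?move = "\<lambda>s \<omega>. of_bool (X (Suc n) \<omega> = s) * F (h s) (path \<omega>)"
  have move_meas: "?move s \<in> borel_measurable M" for s
    by measurable
  have move_int: "integrable M (?move s)" for s
    using F01[of s] by (intro integrable_const_bound[where B=1] move_meas) auto
  have walk_Suc: "walk X (Suc n) \<omega> = walk X n \<omega> + X (Suc n) \<omega>" for \<omega>
    by (simp add: walk_def)
  have split: "of_bool (alive b (\<lambda>k. walk X k \<omega>) (Suc n)) * g (walk X (Suc n) \<omega>) =
      ?move 1 \<omega> + ?move (- 1) \<omega>" if "X (Suc n) \<omega> = 1 \<or> X (Suc n) \<omega> = - 1" for \<omega>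
    using that by (auto simp: F_path alive_Suc walk_Suc h_def of_bool_conj)
  have lhs_meas: "(\<lambda>\<omega>. of_bool (alive b (\<lambda>k. walk X k \<omega>) (Suc n)) * g (walk X (Suc n) \<omega>))
      \<in> borel_measurable M"
  proof -
    let ?F = "\<lambda>v. of_bool (alive b (\<lambda>k. \<Sum>i=1..k. v i) (Suc n)) * g (\<Sum>i=1..Suc n. v i)"
    have "?F (restrict (\<lambda>i. X i \<omega>) {1..Suc n}) =
        of_bool (alive b (\<lambda>k. walk X k \<omega>) (Suc n)) * g (walk X (Suc n) \<omega>)" for \<omega>
    proof -
      have "(\<Sum>i=1..k. restrict (\<lambda>i. X i \<omega>) {1..Suc n} i) = walk X k \<omega>" if "k \<le> Suc n" for k
        unfolding walk_def using that by (intro sum.cong) auto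
      then show ?thesis
        by (simp add: alive_def del: sum.cl_ivl_Suc)
    qed
    then show ?thesis
      using measurable_path_function[of ?F "Suc n"] by simp
  qed
  have "expectation (\<lambda>\<omega>. of_bool (alive b (\<lambda>k. walk X k \<omega>) (Suc n)) * g (walk X (Suc n) \<omega>)) =
      expectation (\<lambda>\<omega>. ?move 1 \<omega> + ?move (- 1) \<omega>)"
  proof (rule integral_cong_AE)
    show "AE \<omega> in M. of_bool (alive b (\<lambda>k. walk X k \<omega>) (Suc n)) * g (walk X (Suc n) \<omega>) =
        ?move 1 \<omega> + ?move (- 1) \<omega>"
      using AE_step[of n] by (rule eventually_mono) (rule split)
  qed (intro lhs_meas borel_measurable_add move_meas)+
  also have "\<dots> = expectation (?move 1) + expectation (?move (- 1))"
    by (rule Bochner_Integration.integral_add[OF move_int move_int])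
  also have "\<dots> = p * expectation (\<lambda>\<omega>. F (h 1) (path \<omega>)) +
      (1 - p) * expectation (\<lambda>\<omega>. F (h (- 1)) (path \<omega>))"
    using expectation_next_step[of "F (h 1)" n 1, OF F01]
      expectation_next_step[of "F (h (- 1))" n "- 1", OF F01]
    unfolding path_def by (simp add: prob_step_up prob_step_down)
  also have "\<dots> = expectation (\<lambda>\<omega>. p * F (h 1) (path \<omega>) + (1 - p) * F (h (- 1)) (path \<omega>))"
    using F_int by simp
  also have "\<dots> = expectation (\<lambda>\<omega>. of_bool (alive b (\<lambda>k. walk X k \<omega>) n) *
      walk_step p (b (Suc n)) g (walk X n \<omega>))"
    by (rule Bochner_Integration.integral_cong) (auto simp: F_path h_def walk_step_def)
  also have "\<dots> = walk_value p b (Suc n) g 0"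
    using Suc.IH[OF walk_step_bounds[OF p_bounds Suc.prems]] by simp
  finally show ?case .
qed

lemma prob_exit_time_greater:
  "prob {\<omega> \<in> space M. exit_time b X \<omega> > enat n} = walk_value p b n (\<lambda>_. 1) 0"
proof -
  have "prob {\<omega> \<in> space M. exit_time b X \<omega> > enat n} =
      expectation (indicator {\<omega> \<in> space M. exit_time b X \<omega> > enat n} :: 'a \<Rightarrow> real)"
    by (simp add: Int_def conj_commute)
  also have "\<dots> = expectation (\<lambda>\<omega>. of_bool (alive b (\<lambda>k. walk X k \<omega>) n) * 1)"
    by (intro Bochner_Integration.integral_cong) (auto simp: exit_time_greater_iff indicator_def)
  also have "\<dots> = walk_value p b n (\<lambda>_. 1) 0"
    by (rule expectation_alive_reward) simp
  finally show ?thesis .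
qed

end

section \<open>The absolute value of the walk\<close>

text \<open>
  With \<open>c = p q\<close>, \<open>p + q = 1\<close>, this is the ratio \<open>(p\<^bsup>k+1\<^esup> + q\<^bsup>k+1\<^esup>) / (p\<^sup>k + q\<^sup>k)\<close> of consecutive power
  sums, written as a continued fraction in \<open>c\<close> alone. For \<open>k \<ge> 1\<close> it is the probability that \<open>\<bar>S\<bar>\<close>
  moves up from \<open>k\<close>; the value \<open>1/2\<close> at \<open>k = 0\<close> only starts the recursion, since from \<open>0\<close> the
  chain \<open>\<bar>S\<bar>\<close> always moves up.
\<close>

primrec up_ratio :: "real \<Rightarrow> nat \<Rightarrow> real" where
  "up_ratio c 0 = 1 / 2"
| "up_ratio c (Suc k) = 1 - c / up_ratio c k"

lemma up_ratio_bounds: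
  assumes "0 \<le> c" and "c \<le> 1 / 4"
  shows "up_ratio c k \<in> {1 / 2..1}"
proof (induction k)
  case (Suc k)
  then have "c / up_ratio c k \<le> (1 / 4) / (1 / 2)"
    using assms by (intro frac_le) auto
  moreover have "0 \<le> c / up_ratio c k"
    using assms Suc by auto
  ultimately show ?case
    by simp
qed simp

text \<open>
  A larger \<open>c\<close> enlarges \<open>c / f\<close> twice: through the numerator, and by induction through the
  denominator \<open>f\<close>, which is at least \<open>1/2\<close>.
\<close>

lemma up_ratio_antimono:
  assumes "0 \<le> c" and "c \<le> c'" and "c' \<le> 1 / 4"
  shows "up_ratio c' k \<le> up_ratio c k"
proof (induction k)
  case (Suc k)
  have "up_ratio c' k \<ge> 1 / 2"
    using up_ratio_bounds[of c' k] assms by simp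
  then have "c / up_ratio c k \<le> c' / up_ratio c' k"
    using assms Suc by (intro frac_le) auto
  then show ?case
    by simp
qed simp

text \<open>
  As \<open>p\<close> and \<open>q\<close> are the roots of \<open>x\<^sup>2 = x - c\<close>, their power sums \<open>s\<^sub>k\<close> satisfy
  \<open>s\<^bsub>k+2\<^esub> = s\<^bsub>k+1\<^esub> - c s\<^sub>k\<close>; division by \<open>s\<^bsub>k+1\<^esub>\<close> is the recursion of the ratios.
\<close>

lemma up_ratio_power_sum:
  assumes "p \<in> {0..1}"
  shows "up_ratio (p * (1 - p)) k * (p ^ k + (1 - p) ^ k) = p ^ Suc k + (1 - p) ^ Suc k"
proof (induction k)
  case (Suc k)
  let ?c = "p * (1 - p)"
  have "0 \<le> (p - 1 / 2)\<^sup>2"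
    by simp
  then have "?c \<le> 1 / 4"
    by (simp add: power2_eq_square algebra_simps)
  then have "up_ratio ?c k \<noteq> 0"
    using up_ratio_bounds[of ?c k] assms by auto
  then have "?c / up_ratio ?c k * (up_ratio ?c k * (p ^ k + (1 - p) ^ k)) = ?c * (p ^ k + (1 - p) ^ k)"
    by simp
  then have "up_ratio ?c (Suc k) * (p ^ Suc k + (1 - p) ^ Suc k) =
      (p ^ Suc k + (1 - p) ^ Suc k) - ?c * (p ^ k + (1 - p) ^ k)"
    unfolding Suc.IH up_ratio.simps left_diff_distrib by (simp only: mult_1_left)
  also have "\<dots> = p ^ Suc (Suc k) + (1 - p) ^ Suc (Suc k)"
    by (simp add: algebra_simps)
  finally show ?case .
qed simp

primrec abs_step :: "real \<Rightarrow> int \<Rightarrow> (nat \<Rightarrow> real) \<Rightarrow> nat \<Rightarrow> real" where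
  "abs_step c \<beta> G 0 = of_bool (1 < \<beta>) * G 1"
| "abs_step c \<beta> G (Suc k) =
    up_ratio c (Suc k) * (of_bool (int (Suc (Suc k)) < \<beta>) * G (Suc (Suc k))) +
    (1 - up_ratio c (Suc k)) * (of_bool (int k < \<beta>) * G k)"

primrec abs_value :: "real \<Rightarrow> (nat \<Rightarrow> int) \<Rightarrow> nat \<Rightarrow> (nat \<Rightarrow> real) \<Rightarrow> nat \<Rightarrow> real" where
  "abs_value c b 0 G = G"
| "abs_value c b (Suc n) G = abs_value c b n (abs_step c (b (Suc n)) G)"

text \<open>
  \<open>G k\<close> is the mean of \<open>g\<close> over \<open>k\<close> and \<open>-k\<close> with weights proportional to \<open>p\<^sup>k\<close> and \<open>q\<^sup>k\<close>, the
  conditional law of the walk given its absolute value.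
\<close>

definition folds_to :: "real \<Rightarrow> (int \<Rightarrow> real) \<Rightarrow> (nat \<Rightarrow> real) \<Rightarrow> bool" where
  "folds_to p g G \<longleftrightarrow>
    (\<forall>k. (p ^ k + (1 - p) ^ k) * G k = p ^ k * g (int k) + (1 - p) ^ k * g (- int k))"

lemma folds_toD:
  "folds_to p g G \<Longrightarrow>
    (p ^ k + (1 - p) ^ k) * G k = p ^ k * g (int k) + (1 - p) ^ k * g (- int k)"
  by (simp add: folds_to_def)

text \<open>
  The weights \<open>p\<^sup>k\<close> at \<open>k\<close> and \<open>q\<^sup>k\<close> at \<open>-k\<close> fit together after one step: the outward moves reach
  \<open>\<plusminus>(k+1)\<close> with weights \<open>p\<^bsup>k+1\<^esup>\<close> and \<open>q\<^bsup>k+1\<^esup>\<close>, and the inward moves reach \<open>\<plusminus>(k-1)\<close> with weights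
  \<open>p q\<close> times \<open>p\<^bsup>k-1\<^esup>\<close> and \<open>q\<^bsup>k-1\<^esup>\<close>. The barrier is symmetric and so does not separate the two points.
\<close>

lemma folds_to_step:
  assumes p: "p \<in> {0..1}" and "folds_to p g G"
  shows "folds_to p (walk_step p \<beta> g) (abs_step (p * (1 - p)) \<beta> G)"
  unfolding folds_to_def
proof
  fix k
  let ?q = "1 - p" and ?c = "p * (1 - p)"
  show "(p ^ k + ?q ^ k) * abs_step ?c \<beta> G k =
    p ^ k * walk_step p \<beta> g (int k) + ?q ^ k * walk_step p \<beta> g (- int k)"
  proof (cases k)
    case 0
    then show ?thesis
      using folds_toD[OF assms(2), of 1] by (auto simp: walk_step_def)
  next
    case (Suc j)
    let ?s = "\<lambda>i. p ^ i + ?q ^ i"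
    \<comment> \<open>barrier indicators after an outward and an inward move\<close>
    define u d :: real where "u = of_bool (int (Suc (Suc j)) < \<beta>)" and "d = of_bool (int j < \<beta>)"
    have up: "?s (Suc j) * up_ratio ?c (Suc j) = ?s (Suc (Suc j))"
      using up_ratio_power_sum[OF p, of "Suc j"] by (simp only: mult.commute)
    have down: "?s (Suc j) * (1 - up_ratio ?c (Suc j)) = ?c * ?s j"
      using up by (simp add: algebra_simps)
    have "?s k * abs_step ?c \<beta> G k =
        (?s (Suc j) * up_ratio ?c (Suc j)) * (u * G (Suc (Suc j))) +
        (?s (Suc j) * (1 - up_ratio ?c (Suc j))) * (d * G j)"
      unfolding Suc u_def d_def abs_step.simps by (simp only: distrib_left mult.assoc)
    also have "\<dots> = u * (?s (Suc (Suc j)) * G (Suc (Suc j))) + ?c * d * (?s j * G j)"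
      unfolding up down by (simp only: mult_ac)
    also have "\<dots> = u * (p ^ Suc (Suc j) * g (int (Suc (Suc j))) +
          ?q ^ Suc (Suc j) * g (- int (Suc (Suc j)))) +
        ?c * d * (p ^ j * g (int j) + ?q ^ j * g (- int j))"
      by (simp only: folds_toD[OF assms(2)])
    also have "\<dots> = p ^ k * (p * (u * g (int (Suc (Suc j)))) + ?q * (d * g (int j))) +
        ?q ^ k * (p * (d * g (- int j)) + ?q * (u * g (- int (Suc (Suc j)))))"
      unfolding Suc by (simp add: algebra_simps)
    also have "\<dots> = p ^ k * walk_step p \<beta> g (int k) + ?q ^ k * walk_step p \<beta> g (- int k)"
    proof -
      have "int k + 1 = int (Suc (Suc j))" "int k - 1 = int j"
        "- int k + 1 = - int j" "- int k - 1 = - int (Suc (Suc j))"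
        using Suc by simp_all
      then show ?thesis
        unfolding walk_step_def u_def d_def by (simp only: abs_minus_cancel abs_of_nat)
    qed
    finally show ?thesis .
  qed
qed

lemma walk_value_eq_abs_value:
  assumes "p \<in> {0..1}" and "folds_to p g G"
  shows "walk_value p b n g 0 = abs_value (p * (1 - p)) b n G 0"
  using assms(2)
proof (induction n arbitrary: g G)
  case 0
  then show ?case
    using folds_toD[of p g G 0] by simp
next
  case (Suc n)
  then show ?case
    using folds_to_step[OF assms(1)] by simp
qed

section \<open>Monotonicity in the product of the step probabilities\<close>

text \<open>
  Only positions of equal parity are compared, because \<open>\<bar>S\<bar>\<close> has period two. Nonnegativity is
  included so that killing at a barrier preserves the property.
\<close>

definition two_step_decreasing :: "(nat \<Rightarrow> real) \<Rightarrow> bool" where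
  "two_step_decreasing G \<longleftrightarrow> (\<forall>k. 0 \<le> G k \<and> G (Suc (Suc k)) \<le> G k)"

lemma two_step_decreasing_killed:
  assumes "two_step_decreasing G"
  shows "two_step_decreasing (\<lambda>k. of_bool (int k < \<beta>) * G k)"
  using assms by (auto simp: two_step_decreasing_def)

text \<open>
  The non-crossing of the chain: after one step from \<open>k + 2\<close> the position is at least \<open>k + 1\<close>, and
  after one step from \<open>k\<close> it is at most \<open>k + 1\<close>. So the killed reward at \<open>k + 1\<close> separates the two
  averages, and the transition probabilities do not matter.
\<close>

lemma two_step_decreasing_step:
  assumes c: "0 \<le> c" "c \<le> 1 / 4" and "two_step_decreasing G"
  shows "two_step_decreasing (abs_step c \<beta> G)"
proof -
  define H where "H k = of_bool (int k < \<beta>) * G k" for k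
  have H: "0 \<le> H k" "H (Suc (Suc k)) \<le> H k" for k
    using two_step_decreasing_killed[OF assms(3), of \<beta>] by (auto simp: two_step_decreasing_def H_def)
  have u: "0 \<le> up_ratio c k" "0 \<le> 1 - up_ratio c k" for k
    using up_ratio_bounds[OF c, of k] by auto
  have step_0: "abs_step c \<beta> G 0 = H 1"
    by (simp add: H_def)
  have step_Suc: "abs_step c \<beta> G (Suc k) =
      up_ratio c (Suc k) * H (Suc (Suc k)) + (1 - up_ratio c (Suc k)) * H k" for k
    by (simp add: H_def)
  have upper: "abs_step c \<beta> G (Suc k) \<le> H k" for k
    unfolding step_Suc by (rule convex_bound_le[OF H(2) order_refl u(1) u(2)]) simp
  have lower: "H (Suc k) \<le> abs_step c \<beta> G k" for k
  proof (cases k)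
    case (Suc j)
    have "- abs_step c \<beta> G (Suc j) =
        up_ratio c (Suc j) * (- H (Suc (Suc j))) + (1 - up_ratio c (Suc j)) * (- H j)"
      unfolding step_Suc by simp
    also have "\<dots> \<le> - H (Suc (Suc j))"
      by (rule convex_bound_le[OF order_refl _ u(1) u(2)]) (use H(2)[of j] in simp_all)
    finally show ?thesis
      using Suc by simp
  next
    case 0
    then show ?thesis
      using step_0 by simp
  qed
  have "0 \<le> abs_step c \<beta> G k" for k
    using lower[of k] H(1)[of "Suc k"] by linarith
  moreover have "abs_step c \<beta> G (Suc (Suc k)) \<le> abs_step c \<beta> G k" for k
    using upper[of "Suc k"] lower[of k] by linarith
  ultimately show ?thesis
    by (simp add: two_step_decreasing_def)
qed

text \<open>
  For \<open>k \<ge> 1\<close>, a larger \<open>c\<close> shifts weight from \<open>k + 1\<close> to \<open>k - 1\<close>, where a two-step decreasing reward is at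
  least as large.
\<close>

lemma abs_step_mono:
  assumes c: "0 \<le> c" "c \<le> c'" "c' \<le> 1 / 4"
    and "two_step_decreasing G" and le: "\<And>k. G k \<le> G' k"
  shows "abs_step c \<beta> G k \<le> abs_step c' \<beta> G' k"
proof (cases k)
  case 0
  then show ?thesis
    using le[of 1] by simp
next
  case (Suc j)
  define H H' where "H i = of_bool (int i < \<beta>) * G i" and "H' i = of_bool (int i < \<beta>) * G' i" for i
  let ?u = "up_ratio c (Suc j)" and ?u' = "up_ratio c' (Suc j)"
  have H: "H (Suc (Suc j)) \<le> H j"
    using two_step_decreasing_killed[OF assms(4), of \<beta>] by (auto simp: two_step_decreasing_def H_def)
  have le': "H i \<le> H' i" for i
    using le[of i] by (simp add: H_def H'_def)
  have u': "0 \<le> ?u'" "0 \<le> 1 - ?u'"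
    using up_ratio_bounds[of c' "Suc j"] c by (auto simp del: up_ratio.simps)
  have "(?u - ?u') * (H j - H (Suc (Suc j))) \<ge> 0"
    using up_ratio_antimono[OF c, of "Suc j"] H
    by (intro mult_nonneg_nonneg) (auto simp del: up_ratio.simps)
  then have "?u * H (Suc (Suc j)) + (1 - ?u) * H j \<le> ?u' * H (Suc (Suc j)) + (1 - ?u') * H j"
    by (simp only: algebra_simps)
  also have "\<dots> \<le> ?u' * H' (Suc (Suc j)) + (1 - ?u') * H' j"
    by (intro add_mono mult_left_mono le' u')
  finally show ?thesis
    unfolding Suc abs_step.simps H_def H'_def .
qed

lemma abs_value_mono:
  assumes c: "0 \<le> c" "c \<le> c'" "c' \<le> 1 / 4"
    and "two_step_decreasing G" and "\<And>k. G k \<le> G' k"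
  shows "abs_value c b n G k \<le> abs_value c' b n G' k"
  using assms(4,5)
proof (induction n arbitrary: G G')
  case (Suc n)
  have "two_step_decreasing (abs_step c (b (Suc n)) G)"
    using c Suc.prems(1) by (intro two_step_decreasing_step) auto
  moreover have "abs_step c (b (Suc n)) G k \<le> abs_step c' (b (Suc n)) G' k" for k
    by (rule abs_step_mono[OF c Suc.prems])
  ultimately show ?case
    using Suc.IH by simp
qed simp

text \<open>
  One comparison covers both halves of \<open>[0, 1]\<close>: the law of the exit time is the same for \<open>p\<close> and
  \<open>1 - p\<close>, and \<open>p (1 - p)\<close> measures the distance of \<open>p\<close> from \<open>1/2\<close>.
\<close>

lemma prob_exit_time_greater_mono:
  assumes "bernoulli_steps M X p" and "bernoulli_steps M' X' p'"
    and le: "p * (1 - p) \<le> p' * (1 - p')"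
  shows "measure M {\<omega> \<in> space M. exit_time b X \<omega> > enat n} \<le>
    measure M' {\<omega> \<in> space M'. exit_time b X' \<omega> > enat n}"
proof -
  have p: "p \<in> {0..1}" "p' \<in> {0..1}"
    using assms(1,2) by (auto dest: bernoulli_steps.p_bounds)
  have "0 \<le> (p' - 1 / 2)\<^sup>2"
    by simp
  then have quarter: "p' * (1 - p') \<le> 1 / 4"
    by (simp add: power2_eq_square algebra_simps)
  have fold: "folds_to r (\<lambda>_. 1) (\<lambda>_. 1)" for r
    by (simp add: folds_to_def)
  have "abs_value (p * (1 - p)) b n (\<lambda>_. 1) 0 \<le> abs_value (p' * (1 - p')) b n (\<lambda>_. 1) 0"
    using p le quarter by (intro abs_value_mono) (auto simp: two_step_decreasing_def)
  then show ?thesis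
    unfolding bernoulli_steps.prob_exit_time_greater[OF assms(1)]
      bernoulli_steps.prob_exit_time_greater[OF assms(2)]
      walk_value_eq_abs_value[OF p(1) fold] walk_value_eq_abs_value[OF p(2) fold] .
qed

theorem corollary1:
  fixes b :: "nat \<Rightarrow> int"
    and M :: "real \<Rightarrow> 'a measure"
    and X :: "real \<Rightarrow> nat \<Rightarrow> 'a \<Rightarrow> int"
  assumes "\<And>n. n \<ge> 1 \<Longrightarrow> b n \<ge> 0"
    and "\<And>p. p \<in> {0..1} \<Longrightarrow> bernoulli_steps (M p) (X p) p"
  shows "stoch_increasing_on {0..1/2} M (\<lambda>p. exit_time b (X p)) \<and>
    stoch_decreasing_on {1/2..1} M (\<lambda>p. exit_time b (X p))"
proof
  have difference: "p' * (1 - p') - p * (1 - p) = (p' - p) * (1 - p - p')" for p p' :: real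
    by (simp add: algebra_simps)
  show "stoch_increasing_on {0..1/2} M (\<lambda>p. exit_time b (X p))"
    unfolding stoch_increasing_on_def
  proof (intro allI impI mono_onI)
    fix n :: nat and p p' :: real
    assume I: "p \<in> {0..1/2}" "p' \<in> {0..1/2}" "p \<le> p'"
    have steps: "bernoulli_steps (M p) (X p) p" "bernoulli_steps (M p') (X p') p'"
      using I by (simp_all add: assms(2))
    from I have "0 \<le> (p' - p) * (1 - p - p')"
      by (intro mult_nonneg_nonneg) auto
    then have "p * (1 - p) \<le> p' * (1 - p')"
      using difference[of p' p] by linarith
    then show "measure (M p) {\<omega> \<in> space (M p). exit_time b (X p) \<omega> > enat n} \<le>
        measure (M p') {\<omega> \<in> space (M p'). exit_time b (X p') \<omega> > enat n}"
      by (rule prob_exit_time_greater_mono[OF steps(1,2)])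
  qed
  show "stoch_decreasing_on {1/2..1} M (\<lambda>p. exit_time b (X p))"
    unfolding stoch_decreasing_on_def
  proof (intro allI impI monotone_onI)
    fix n :: nat and p p' :: real
    assume I: "p \<in> {1/2..1}" "p' \<in> {1/2..1}" "p \<le> p'"
    have steps: "bernoulli_steps (M p) (X p) p" "bernoulli_steps (M p') (X p') p'"
      using I by (simp_all add: assms(2))
    from I have "(p' - p) * (1 - p - p') \<le> 0"
      by (intro mult_nonneg_nonpos) auto
    then have "p' * (1 - p') \<le> p * (1 - p)"
      using difference[of p' p] by linarith
    then show "measure (M p') {\<omega> \<in> space (M p'). exit_time b (X p') \<omega> > enat n} \<le>
        measure (M p) {\<omega> \<in> space (M p). exit_time b (X p) \<omega> > enat n}"
      by (rule prob_exit_time_greater_mono[OF steps(2,1)])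
  qed
qed

end
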